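(* Let $\lambda>1$ and $0<\alpha<1/2$, and let $0<\delta<1-2\alpha$. Then there exist a natural number $n_0$, a sequence of times $0=t_{n_0}<t_{n_0+1}<t_{n_0+2}<\dots$ increasing to a finite limit $T_*$, and continuous, piecewise smooth functions $X_n:[0,T_* )\to\mathbb{R}$ for $n\ge n_0$, such that $X_{n_0+k}(t)=0$ whenever $k\ge1$ and $0\le t\le t_{n_0+k-1}$, and such that $$\partial_tX_n=-\lambda^{2n\alpha}X_n+1_{(t_{n-1},t_n)}(t)\,\lambda^{n-1}X_{n-1}^2-1_{(t_n,t_{n+1})}(t)\,\lambda^nX_nX_{n+1}$$ for all $t\in[0,T_* )$ other than the times $t_{n_0},t_{n_0+1},\dots$, and all $n\ge n_0$, with the convention that $t_{n_0-1}=0$ and $X_{n_0-1}=0$. Furthermore, $$X_{n_0+k}(t_{n_0+k})=\lambda^{-\delta k}$$ for every $k\ge0$. In particular, for any $\delta'>\delta$, $$\limsup_{t\to T_*}\ \sup_{n}\ \lambda^{\delta'n}|X_n(t)|=+\infty.$$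
   Context: $1_{(a,b)}$ denotes the indicator function of the interval $(a,b)$. *)

theory Defs
  imports "HOL-Analysis.Analysis"
begin

(* C-infinity on a set I, meant for nondegenerate intervals: D k is the k-th derivative of f,
   one-sided at those endpoints that belong to I. *)
definition smooth_on_interval :: "(real \<Rightarrow> real) \<Rightarrow> real set \<Rightarrow> bool" where
  "smooth_on_interval f I \<longleftrightarrow>
     (\<exists>D :: nat \<Rightarrow> real \<Rightarrow> real. (\<forall>x\<in>I. D 0 x = f x) \<and>
        (\<forall>k. \<forall>x\<in>I. (D k has_real_derivative D (Suc k) x) (at x within I)))"

(* S is the finite set of break points; on each piece between consecutive break points f is
   smooth up to and including the end points of the piece (as far as these lie in J). *)
definition piecewise_smooth_on :: "(real \<Rightarrow> real) \<Rightarrow> real set \<Rightarrow> bool" where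
  "piecewise_smooth_on f J \<longleftrightarrow>
     (\<exists>S. finite S \<and>
        (\<forall>a b. a < b \<and> {a..b} \<subseteq> J \<and> {a<..<b} \<inter> S = {} \<longrightarrow> smooth_on_interval f {a..b}))"

end

theory Submission
  imports Defs
begin

text \<open>
  On each time interval only two neighbouring modes interact. After rescaling time by the
  nonlinear rate they solve \<open>u' = - p u - u v\<close>, \<open>v' = - q v + u\<^sup>2\<close> with \<open>u 0 = 1\<close> and \<open>v 0 = 0\<close>.
  The energy \<open>u\<^sup>2 + v\<^sup>2\<close> decays at most like \<open>exp (- 2 q t)\<close>, so as long as \<open>v < \<theta> < 1\<close> and
  \<open>q\<close> is small, \<open>v' \<ge> (1 - \<theta>\<^sup>2) / 2\<close>; hence \<open>v\<close> reaches \<open>\<theta> = lam powr (- \<delta>)\<close> within a time that does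
  not depend on \<open>p\<close> and \<open>q\<close>. In the original variables the rescaled dissipation of step \<open>k\<close> is at most
  \<open>lam powr (2 \<alpha> - (1 - 2 \<alpha>) n0)\<close> because \<open>\<delta> < 1 - 2 \<alpha>\<close>, so a large \<open>n0\<close> makes every step succeed,
  and the step lengths are dominated by a geometric series.
\<close>

section \<open>Energy transfer between two modes\<close>

lemma at_within_atLeast_eq: "at t within {0..} = at t within {0..t + 1}" if "0 \<le> t" for t :: real
  using that by (intro at_within_nhd[of t "{..<t + 1}"]) auto

lemma integral_has_vector_derivative_atLeast:
  fixes h :: "real \<Rightarrow> 'a::banach"
  assumes "continuous_on UNIV h" and "0 \<le> t"
  shows "((\<lambda>u. integral {0..u} h) has_vector_derivative h t) (at t within {0..})"
  unfolding at_within_atLeast_eq[OF assms(2)]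
  by (rule integral_has_vector_derivative)
    (use assms in \<open>auto intro: continuous_on_subset\<close>)

text \<open>Integrating a function of growth \<open>exp (M * s)\<close> gains the factor
  \<open>1 / M\<close>. This gain makes the Picard operator below a contraction on the whole half
  line.\<close>

lemma norm_integral_exp_bound:
  fixes h :: "real \<Rightarrow> 'a::banach"
  assumes "continuous_on UNIV h" and bd: "\<And>s. 0 \<le> s \<Longrightarrow> norm (h s) \<le> C * exp (M * s)"
    and "0 < M" and "0 \<le> t"
  shows "norm (integral {0..t} h) \<le> C * exp (M * t) / M"
proof -
  have "0 \<le> C" using order_trans[OF norm_ge_zero bd[of 0]] by simp
  have int: "((\<lambda>s. C * exp (M * s)) has_integral C * exp (M * t) / M - C * exp (M * 0) / M) {0..t}"
    by (rule fundamental_theorem_of_calculus)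
      (use assms in \<open>auto intro!: derivative_eq_intros
         simp flip: has_real_derivative_iff_has_vector_derivative\<close>)
  have "norm (integral {0..t} h) \<le> integral {0..t} (\<lambda>s. C * exp (M * s))"
    by (rule integral_norm_bound_integral)
      (use assms int in \<open>auto intro!: integrable_continuous_real continuous_intros
        intro: continuous_on_subset\<close>)
  also have "\<dots> = C * exp (M * t) / M - C / M" using integral_unique[OF int] by simp
  also have "\<dots> \<le> C * exp (M * t) / M" using \<open>0 \<le> C\<close> \<open>0 < M\<close> by simp
  finally show ?thesis .
qed

text \<open>Banach's fixed point theorem in Bielecki's weighted norm: with
  \<open>x t = exp (M * t) *\<^sub>R w t\<close> and \<open>w\<close> bounded and continuous, the
  Picard operator contracts with factor \<open>L / M \<le> 1 / 2\<close>. The solution is therefore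
  global at once, with no continuation of local solutions.\<close>

lemma global_picard_lindelof:
  fixes f :: "'a::banach \<Rightarrow> 'a"
  assumes lip: "L-lipschitz_on UNIV f"
  shows "\<exists>x. x 0 = x0 \<and> (\<forall>t\<ge>0. (x has_vector_derivative f (x t)) (at t within {0..}))"
proof -
  have "0 \<le> L" using lip lipschitz_on_nonneg by blast
  \<comment> \<open>The summand 1 keeps \<open>M\<close> positive when \<open>L = 0\<close>.\<close>
  define M where "M = 2 * L + 1"
  have M: "0 < M" "2 * L \<le> M" using \<open>0 \<le> L\<close> by (auto simp: M_def)
  have cf: "continuous_on UNIV f" using lip by (rule lipschitz_on_continuous_on)
  have lip': "norm (f a - f b) \<le> L * norm (a - b)" for a b
    using lipschitz_onD[OF lip, of a b] by (simp add: dist_norm)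
  \<comment> \<open>\<open>h w\<close> is the right-hand side evaluated along the unweighted path,
    and \<open>g w\<close> is the weighted Picard iterate. Bounded continuous functions live on all
    of \<real>, so \<open>max 0 t\<close> extends \<open>g w\<close> to negative times by its value
    at 0.\<close>
  define h where "h w s = f (exp (M * s) *\<^sub>R apply_bcontfun w s)" for w s
  define g where "g w t = exp (- M * max 0 t) *\<^sub>R (x0 + integral {0..max 0 t} (h w))" for w t
  have ch: "continuous_on UNIV (h w)" for w
    unfolding h_def by (intro continuous_on_compose2[OF cf] continuous_intros) auto
  have hb: "norm (h w s) \<le> (norm (f 0) + L * norm w) * exp (M * s)" if "0 \<le> s" for w s
  proof -
    have "norm (h w s) \<le> norm (f 0) + L * (exp (M * s) * norm (apply_bcontfun w s))"
      using lip'[of "exp (M * s) *\<^sub>R apply_bcontfun w s" 0]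
        norm_triangle_sub[of "h w s" "f 0"] by (auto simp: h_def)
    also have "\<dots> \<le> norm (f 0) * exp (M * s) + L * (exp (M * s) * norm w)"
      using M that \<open>0 \<le> L\<close> norm_bounded[of w s]
      by (intro add_mono mult_left_mono) (auto intro: mult_left_le[of 1 "norm (f 0)", simplified]
          simp: mult_le_cancel_left1)
    finally show ?thesis by (simp add: algebra_simps)
  qed
  have gb: "g w \<in> bcontfun" for w
  proof (rule bcontfun_normI)
    have "continuous_on {0..} (\<lambda>t. integral {0..t} (h w))"
      unfolding continuous_on_eq_continuous_within
      using integral_has_vector_derivative_atLeast[OF ch]
      by (auto intro: has_vector_derivative_continuous)
    then have "continuous_on UNIV (\<lambda>t. integral {0..max 0 t} (h w))"
      by (rule continuous_on_compose2) (auto intro!: continuous_intros)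
    then show "continuous_on UNIV (g w)"
      unfolding g_def by (intro continuous_intros)
    show "norm (g w t) \<le> norm x0 + (norm (f 0) + L * norm w) / M" for t
    proof -
      define u where "u = max 0 t"
      have u: "0 \<le> u" by (simp add: u_def)
      have "norm (g w t) \<le> exp (- M * u) * norm x0 + exp (- M * u) * norm (integral {0..u} (h w))"
        unfolding g_def u_def[symmetric] by (simp add: norm_triangle_ineq flip: distrib_left)
      also have "\<dots> \<le> 1 * norm x0
          + exp (- M * u) * ((norm (f 0) + L * norm w) * exp (M * u) / M)"
        using M u by (intro add_mono mult_right_mono mult_left_mono norm_integral_exp_bound ch hb) auto
      also have "\<dots> = norm x0 + (norm (f 0) + L * norm w) / M"
        by (simp add: exp_minus)
      finally show ?thesis .
    qed
  qed
  have contr: "dist (Bcontfun (g w)) (Bcontfun (g z)) \<le> 1 / 2 * dist w z" for w z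
  proof (rule dist_bound)
    fix t :: real
    define u where "u = max 0 t"
    have u: "0 \<le> u" by (simp add: u_def)
    have "dist (g w t) (g z t) = exp (- M * u) * norm (integral {0..u} (h w) - integral {0..u} (h z))"
      unfolding g_def u_def[symmetric] dist_norm by (simp flip: scaleR_diff_right)
    also have "integral {0..u} (h w) - integral {0..u} (h z) = integral {0..u} (\<lambda>s. h w s - h z s)"
      by (intro integral_diff[symmetric] integrable_continuous_real continuous_on_subset[OF ch]) auto
    also have "norm \<dots> \<le> L * dist w z * exp (M * u) / M"
    proof (rule norm_integral_exp_bound)
      fix s :: real
      have "norm (h w s - h z s) \<le> L * (exp (M * s) * dist (apply_bcontfun w s) (apply_bcontfun z s))"
        using lip'[of "exp (M * s) *\<^sub>R apply_bcontfun w s" "exp (M * s) *\<^sub>R apply_bcontfun z s"]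
        by (simp add: h_def dist_norm flip: scaleR_diff_right)
      also have "\<dots> \<le> L * (exp (M * s) * dist w z)"
        using \<open>0 \<le> L\<close> by (intro mult_left_mono dist_bounded) auto
      finally show "norm (h w s - h z s) \<le> L * dist w z * exp (M * s)" by (simp add: mult_ac)
    qed (use M u ch in \<open>auto intro!: continuous_intros\<close>)
    also have "exp (- M * u) * (L * dist w z * exp (M * u) / M) = L / M * dist w z"
      by (simp add: exp_minus)
    also have "\<dots> \<le> 1 / 2 * dist w z"
      using M by (intro mult_right_mono) (auto simp: divide_simps)
    finally show "dist (apply_bcontfun (Bcontfun (g w)) t) (apply_bcontfun (Bcontfun (g z)) t)
        \<le> 1 / 2 * dist w z"
      by (simp add: Bcontfun_inverse gb)
  qed
  obtain w where "Bcontfun (g w) = w"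
    using banach_fix_type[of "1/2" "\<lambda>w. Bcontfun (g w)"] contr by auto
  then have w: "g w = apply_bcontfun w" using Bcontfun_inverse[OF gb] by metis
  \<comment> \<open>Removing the weight from the fixed point: for \<open>t \<ge> 0\<close> this is
    \<open>exp (M * t) *\<^sub>R w t\<close>, so \<open>x\<close> satisfies the integral
    equation.\<close>
  define x where "x t = x0 + integral {0..t} (h w)" for t
  have hx: "h w t = f (x t)" if "0 \<le> t" for t
    using that by (simp add: h_def x_def exp_minus flip: w, simp add: g_def exp_minus)
  have "(x has_vector_derivative f (x t)) (at t within {0..})" if "0 \<le> t" for t
    unfolding x_def[abs_def] hx[OF that, unfolded x_def, symmetric]
    using integral_has_vector_derivative_atLeast[OF ch that, of w]
    by (auto intro!: derivative_eq_intros)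
  moreover have "x 0 = x0" by (simp add: x_def)
  ultimately show ?thesis by blast
qed

section \<open>The two-mode system: existence, energy and transfer time\<close>

lemma nondecreasing_if_deriv_within_nonneg:
  fixes f :: "real \<Rightarrow> real"
  assumes der: "\<And>s. 0 \<le> s \<Longrightarrow> s \<le> t \<Longrightarrow> (f has_real_derivative f' s) (at s within {0..})"
    and nonneg: "\<And>s. 0 < s \<Longrightarrow> s < t \<Longrightarrow> 0 \<le> f' s" and "0 \<le> t"
  shows "f 0 \<le> f t"
proof (rule DERIV_nonneg_imp_increasing_open[OF \<open>0 \<le> t\<close>])
  fix s assume s: "0 < s" "s < t"
  have "at s within {0..} = at s" using s by (intro at_within_interior) simp
  then show "\<exists>y. (f has_real_derivative y) (at s) \<and> 0 \<le> y"
    using der[of s] nonneg[of s] s by auto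
next
  show "continuous_on {0..t} f"
    by (rule DERIV_continuous_on[of _ _ f'], rule DERIV_subset[OF der]) auto
qed

lemma two_mode_solution:
  fixes p q :: real
  assumes "0 \<le> p" and "0 \<le> q"
  obtains u v :: "real \<Rightarrow> real"
  where "u 0 = 1" and "v 0 = 0"
    and "\<And>t. 0 \<le> t \<Longrightarrow> (u has_real_derivative - p * u t - u t * v t) (at t within {0..})"
    and "\<And>t. 0 \<le> t \<Longrightarrow> (v has_real_derivative - q * v t + (u t)\<^sup>2) (at t within {0..})"
    and "\<And>t. 0 \<le> t \<Longrightarrow> 0 \<le> v t"
proof -
  \<comment> \<open>In the variables \<open>z = - ln u\<close> and \<open>v\<close> the vector field is globally Lipschitz on \<open>z \<ge> 0\<close>.\<close>
  define f :: "real \<times> real \<Rightarrow> real \<times> real"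
    where "f = (\<lambda>(z, v). (p + v, - q * v + exp (- 2 * max 0 z)))"
  have explip: "\<bar>exp (- 2 * max 0 a) - exp (- 2 * max 0 b)\<bar> \<le> 2 * \<bar>a - b\<bar>" for a b :: real
  proof -
    have *: "exp (- 2 * max 0 a) - exp (- 2 * max 0 b) \<le> 2 * \<bar>a - b\<bar>" for a b :: real
    proof -
      \<comment> \<open>This is \<open>1 - exp (- y) \<le> y\<close>, valid for either sign of
        \<open>y\<close>, so no case distinction between \<open>a\<close> and \<open>b\<close> is
        needed.\<close>
      have "1 - exp (- 2 * (max 0 b - max 0 a)) \<le> 2 * (max 0 b - max 0 a)"
        using exp_ge_add_one_self[of "- 2 * (max 0 b - max 0 a)"] by linarith
      also have "\<dots> \<le> 2 * \<bar>a - b\<bar>" by (simp add: max_def abs_if)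
      finally have 1: "1 - exp (- 2 * (max 0 b - max 0 a)) \<le> 2 * \<bar>a - b\<bar>" .
      have "exp (- 2 * max 0 a) - exp (- 2 * max 0 b)
          = exp (- 2 * max 0 a) * (1 - exp (- 2 * (max 0 b - max 0 a)))"
        by (simp add: right_diff_distrib mult_exp_exp)
      also have "\<dots> \<le> exp (- 2 * max 0 a) * (2 * \<bar>a - b\<bar>)"
        using 1 by (intro mult_left_mono) auto
      also have "\<dots> \<le> 1 * (2 * \<bar>a - b\<bar>)" by (intro mult_right_mono) auto
      finally show ?thesis by simp
    qed
    from *[of a b] *[of b a] show ?thesis by (auto simp: abs_le_iff abs_minus_commute)
  qed
  have "(3 + q)-lipschitz_on UNIV f"
  proof (rule lipschitz_onI)
    fix a b :: "real \<times> real"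
    obtain z v z' v' where ab: "a = (z, v)" "b = (z', v')" by (cases a, cases b) auto
    let ?d = "dist a b"
    have d: "\<bar>z - z'\<bar> \<le> ?d" "\<bar>v - v'\<bar> \<le> ?d"
      using dist_fst_le[of a b] dist_snd_le[of a b] by (auto simp: ab dist_real_def)
    have "dist (f a) (f b) \<le> \<bar>v - v'\<bar>
        + \<bar>(- q * v + exp (- 2 * max 0 z)) - (- q * v' + exp (- 2 * max 0 z'))\<bar>"
      unfolding ab f_def dist_norm by (auto intro: order_trans[OF norm_Pair_le])
    also have "\<dots> \<le> \<bar>v - v'\<bar> + (\<bar>q * (v - v')\<bar> + 2 * \<bar>z - z'\<bar>)"
      using explip[of z z'] unfolding right_diff_distrib by linarith
    also have "\<dots> \<le> ?d + (q * ?d + 2 * ?d)"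
      using d assms by (intro add_mono mult_left_mono) (auto simp: abs_mult mult_left_mono)
    finally show "dist (f a) (f b) \<le> (3 + q) * ?d" by (simp add: algebra_simps)
  qed (use assms in simp)
  from global_picard_lindelof[OF this, of 0] obtain x where x0: "x 0 = 0"
    and x: "\<And>t. 0 \<le> t \<Longrightarrow> (x has_vector_derivative f (x t)) (at t within {0..})" by auto
  define z where "z t = fst (x t)" for t
  define v where "v t = snd (x t)" for t
  have f: "f (x t) = (p + v t, - q * v t + exp (- 2 * max 0 (z t)))" for t
    by (simp add: f_def z_def v_def case_prod_beta)
  have z': "(z has_real_derivative p + v t) (at t within {0..})" if "0 \<le> t" for t
    using bounded_linear.has_vector_derivative[OF bounded_linear_fst x[OF that]]
    by (simp add: f has_real_derivative_iff_has_vector_derivative z_def[abs_def])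
  have v': "(v has_real_derivative - q * v t + exp (- 2 * max 0 (z t))) (at t within {0..})"
    if "0 \<le> t" for t
    using bounded_linear.has_vector_derivative[OF bounded_linear_snd x[OF that]]
    by (simp add: f has_real_derivative_iff_has_vector_derivative v_def[abs_def])
  \<comment> \<open>The integrating factor \<open>exp (q * t)\<close> cancels the damping and leaves
    only the positive source.\<close>
  have v0: "0 \<le> v t" if "0 \<le> t" for t
  proof -
    have "exp (q * 0) * v 0 \<le> exp (q * t) * v t"
    proof (rule nondecreasing_if_deriv_within_nonneg[where f = "\<lambda>t. exp (q * t) * v t"])
      show "((\<lambda>t. exp (q * t) * v t) has_real_derivative exp (q * s) * exp (- 2 * max 0 (z s)))
          (at s within {0..})" if "0 \<le> s" for s
        using v'[OF that] by (auto intro!: derivative_eq_intros simp: algebra_simps)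
    qed (use that in auto)
    then show ?thesis using x0 by (simp add: v_def zero_le_mult_iff)
  qed
  \<comment> \<open>Since \<open>z' = p + v \<ge> 0\<close>, the path never enters the region where
    \<open>max 0 z\<close> differs from \<open>z\<close>. Hence the source in the equation for
    \<open>v\<close> really is \<open>u\<^sup>2\<close>.\<close>
  have z0: "0 \<le> z t" if "0 \<le> t" for t
  proof -
    have "z 0 \<le> z t"
      by (rule nondecreasing_if_deriv_within_nonneg[OF z']) (use that v0 assms in auto)
    then show ?thesis using x0 by (simp add: z_def)
  qed
  define u where "u t = exp (- z t)" for t
  show thesis
  proof
    show "u 0 = 1" "v 0 = 0" by (auto simp: u_def z_def v_def x0)
    show "(u has_real_derivative - p * u t - u t * v t) (at t within {0..})" if "0 \<le> t" for t
      unfolding u_def[abs_def] using z'[OF that]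
      by (auto intro!: derivative_eq_intros simp: algebra_simps)
    show "(v has_real_derivative - q * v t + (u t)\<^sup>2) (at t within {0..})" if "0 \<le> t" for t
      using v'[OF that] z0[OF that] by (simp add: u_def flip: exp_double)
  qed (use v0 in auto)
qed

text \<open>\<open>S\<close> is the time needed to climb from 0 to \<theta> at speed
  \<open>(1 - \<theta>\<^sup>2) / 2\<close>. While \<open>v < \<theta>\<close> on
  \<open>[0, S]\<close>, the energy bound gives
  \<open>v' \<ge> (1 - \<theta>\<^sup>2) - q * (\<theta> + 2 * S)\<close>, and the smallness of
  \<open>q\<close> says exactly that the loss is at most half of the gain. So \<open>v\<close>
  cannot stay below \<theta> up to time \<open>S\<close>, and the intermediate value theorem
  provides \<sigma>.\<close>

lemma two_mode_transfer:
  fixes \<theta> :: real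
  assumes "0 < \<theta>" and "\<theta> < 1"
  defines "S \<equiv> 2 * \<theta> / (1 - \<theta>\<^sup>2)"
  assumes "0 \<le> p" and "p \<le> q" and q: "q * (\<theta> + 2 * S) \<le> (1 - \<theta>\<^sup>2) / 2"
  obtains u v :: "real \<Rightarrow> real" and \<sigma> :: real
  where "u 0 = 1" and "v 0 = 0" and "0 < \<sigma>" and "\<sigma> \<le> S" and "v \<sigma> = \<theta>"
    and "\<And>t. 0 \<le> t \<Longrightarrow> (u has_real_derivative - p * u t - u t * v t) (at t within {0..})"
    and "\<And>t. 0 \<le> t \<Longrightarrow> (v has_real_derivative - q * v t + (u t)\<^sup>2) (at t within {0..})"
proof -
  have "0 \<le> q" using assms by simp
  have th: "\<theta>\<^sup>2 < 1" using assms by (simp add: power_less_one_iff)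
  have S: "0 < S" "S * ((1 - \<theta>\<^sup>2) / 2) = \<theta>" using assms th by (auto simp: S_def)
  obtain u v :: "real \<Rightarrow> real" where init: "u 0 = 1" "v 0 = 0"
    and u': "\<And>t. 0 \<le> t \<Longrightarrow> (u has_real_derivative - p * u t - u t * v t) (at t within {0..})"
    and v': "\<And>t. 0 \<le> t \<Longrightarrow> (v has_real_derivative - q * v t + (u t)\<^sup>2) (at t within {0..})"
    and v0: "\<And>t. 0 \<le> t \<Longrightarrow> 0 \<le> v t"
    using two_mode_solution[OF \<open>0 \<le> p\<close> \<open>0 \<le> q\<close>] by metis
  have energy: "1 - 2 * q * t \<le> (u t)\<^sup>2 + (v t)\<^sup>2" if "0 \<le> t" for t
  proof -
    \<comment> \<open>The cubic terms cancel in the derivative of the energy. With the weight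
      \<open>exp (2 * q * t)\<close> only \<open>2 * (q - p) * u\<^sup>2\<close> times the weight
      remains, which is nonnegative because \<open>p \<le> q\<close>.\<close>
    define E where "E t = exp (2 * q * t) * ((u t)\<^sup>2 + (v t)\<^sup>2)" for t
    have "E 0 \<le> E t"
    proof (rule nondecreasing_if_deriv_within_nonneg)
      show "(E has_real_derivative exp (2 * q * s) * (2 * (q - p) * (u s)\<^sup>2)) (at s within {0..})"
        if "0 \<le> s" for s
        unfolding E_def[abs_def] using u'[OF that] v'[OF that]
        by (auto intro!: derivative_eq_intros simp: algebra_simps power2_eq_square)
    qed (use assms that in auto)
    then have "exp (- (2 * q * t)) \<le> (u t)\<^sup>2 + (v t)\<^sup>2"
      by (simp add: E_def init exp_minus field_simps)
    with exp_ge_add_one_self[of "- (2 * q * t)"] show ?thesis by linarith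
  qed
  have "\<exists>t. 0 \<le> t \<and> t \<le> S \<and> \<theta> \<le> v t"
  proof (rule ccontr)
    assume "\<not> ?thesis"
    then have small: "v t < \<theta>" if "0 \<le> t" "t \<le> S" for t using that by force
    have "v 0 - 0 * ((1 - \<theta>\<^sup>2) / 2) \<le> v S - S * ((1 - \<theta>\<^sup>2) / 2)"
    proof (rule nondecreasing_if_deriv_within_nonneg[where f = "\<lambda>t. v t - t * ((1 - \<theta>\<^sup>2) / 2)"])
      show "((\<lambda>t. v t - t * ((1 - \<theta>\<^sup>2) / 2)) has_real_derivative
          - q * v s + (u s)\<^sup>2 - (1 - \<theta>\<^sup>2) / 2) (at s within {0..})" if "0 \<le> s" for s
        using v'[OF that] by (auto intro!: derivative_eq_intros)
      show "0 \<le> - q * v s + (u s)\<^sup>2 - (1 - \<theta>\<^sup>2) / 2" if "0 < s" "s < S" for s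
      proof -
        have "(v s)\<^sup>2 \<le> \<theta>\<^sup>2" using small[of s] v0[of s] that by (intro power_mono) auto
        moreover have "q * v s \<le> q * \<theta>" using small[of s] that \<open>0 \<le> q\<close> by (intro mult_left_mono) auto
        moreover have "2 * q * s \<le> 2 * q * S" using that \<open>0 \<le> q\<close> by (intro mult_left_mono) auto
        moreover have "q * \<theta> + 2 * q * S \<le> (1 - \<theta>\<^sup>2) / 2" using q by (simp only: algebra_simps)
        moreover have "1 - 2 * q * s \<le> (u s)\<^sup>2 + (v s)\<^sup>2" using energy[of s] that by simp
        ultimately show ?thesis unfolding diff_divide_distrib by linarith
      qed
    qed (use S in auto)
    then show False using S small[of S] init by auto
  qed
  then obtain t where t: "0 \<le> t" "t \<le> S" "\<theta> \<le> v t" by auto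
  have "continuous_on {0..t} v"
    by (rule DERIV_continuous_on, rule DERIV_subset[OF v']) auto
  then obtain \<sigma> where \<sigma>: "0 \<le> \<sigma>" "\<sigma> \<le> t" "v \<sigma> = \<theta>"
    using IVT'[of v 0 \<theta> t] t init assms(1) by auto
  moreover have "\<sigma> \<noteq> 0" using \<sigma> init assms(1) by auto
  ultimately show thesis using that[of u v \<sigma>] init u' v' t by auto
qed

text \<open>The substitution \<open>x t = A * u (r * t)\<close>, \<open>y t = A * v (r * t)\<close>
  with \<open>r = c * A\<close> normalises amplitude and coupling to 1 and turns the damping rates
  into \<open>a / r\<close> and \<open>b / r\<close>. \<epsilon> and \<open>S\<close> are fixed
  before \<open>a\<close>, \<open>b\<close>, \<open>c\<close>, \<open>A\<close>: this uniformity
  lets one choice serve every step of the cascade.\<close>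

lemma two_mode_transfer_scaled:
  fixes \<theta> :: real
  assumes \<theta>: "0 < \<theta>" "\<theta> < 1"
  obtains \<epsilon> S :: real where "0 < \<epsilon>" and "0 < S"
    and "\<And>a b c A. \<lbrakk>0 \<le> a; a \<le> b; 0 < c; 0 < A; b \<le> \<epsilon> * (c * A)\<rbrakk> \<Longrightarrow>
      \<exists>\<tau> x y. 0 < \<tau> \<and> \<tau> \<le> S / (c * A) \<and> x 0 = A \<and> y 0 = 0 \<and> y \<tau> = \<theta> * A \<and>
        (\<forall>t\<ge>0. (x has_real_derivative - a * x t - c * x t * y t) (at t within {0..}) \<and>
               (y has_real_derivative - b * y t + c * (x t)\<^sup>2) (at t within {0..}))"
proof -
  have th: "\<theta>\<^sup>2 < 1" using \<theta> by (simp add: power_less_one_iff)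
  define S where "S = 2 * \<theta> / (1 - \<theta>\<^sup>2)"
  define \<epsilon> where "\<epsilon> = (1 - \<theta>\<^sup>2) / 2 / (\<theta> + 2 * S)"
  have S: "0 < S" using \<theta> th by (simp add: S_def)
  have \<epsilon>: "0 < \<epsilon>" using \<theta> th S by (simp add: \<epsilon>_def)
  show thesis
  proof (rule that[OF \<epsilon> S])
    fix a b c A :: real
    assume H: "0 \<le> a" "a \<le> b" "0 < c" "0 < A" "b \<le> \<epsilon> * (c * A)"
    define r where "r = c * A"
    have r: "0 < r" using H by (simp add: r_def)
    have "b / r * (\<theta> + 2 * S) \<le> \<epsilon> * (\<theta> + 2 * S)"
      using H r S \<theta> by (intro mult_right_mono) (auto simp: r_def divide_simps)
    also have "\<dots> = (1 - \<theta>\<^sup>2) / 2"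
      unfolding \<epsilon>_def using S \<theta> by (intro nonzero_eq_divide_eq[THEN iffD1]) auto
    finally have b: "b / r * (\<theta> + 2 * S) \<le> (1 - \<theta>\<^sup>2) / 2" .
    have ar: "0 \<le> a / r" "a / r \<le> b / r" using H r by (auto simp: divide_right_mono)
    obtain u v \<sigma> where uv: "u 0 = 1" "v 0 = 0" "0 < \<sigma>" "\<sigma> \<le> S" "v \<sigma> = \<theta>"
      "\<And>t. 0 \<le> t \<Longrightarrow> (u has_real_derivative - (a / r) * u t - u t * v t) (at t within {0..})"
      "\<And>t. 0 \<le> t \<Longrightarrow> (v has_real_derivative - (b / r) * v t + (u t)\<^sup>2) (at t within {0..})"
      using two_mode_transfer[OF \<theta> ar b[unfolded S_def]] unfolding S_def by metis
    have scale: "((\<lambda>t. A * f (r * t)) has_real_derivative A * (D * r)) (at t within {0..})"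
      if "(f has_real_derivative D) (at (r * t) within {0..})" "0 \<le> t" for f D t
    proof -
      have "(f has_real_derivative D) (at (r * t) within (*) r ` {0..})"
        by (rule DERIV_subset[OF that(1)]) (use r in auto)
      from DERIV_image_chain[OF this, of r]
      have "((\<lambda>t. f (r * t)) has_real_derivative D * r) (at t within {0..})"
        by (auto simp: o_def intro!: derivative_eq_intros)
      then show ?thesis by (rule DERIV_cmult)
    qed
    show "\<exists>\<tau> x y. 0 < \<tau> \<and> \<tau> \<le> S / (c * A) \<and> x 0 = A \<and> y 0 = 0 \<and> y \<tau> = \<theta> * A \<and>
        (\<forall>t\<ge>0. (x has_real_derivative - a * x t - c * x t * y t) (at t within {0..}) \<and>
               (y has_real_derivative - b * y t + c * (x t)\<^sup>2) (at t within {0..}))"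
    proof (intro exI conjI allI impI)
      show "0 < \<sigma> / r" "\<sigma> / r \<le> S / (c * A)"
        using r uv by (auto simp: divide_right_mono simp flip: r_def)
      show "A * u (r * 0) = A" "A * v (r * 0) = 0" "A * v (r * (\<sigma> / r)) = \<theta> * A"
        using r uv by auto
    next
      fix t :: real assume t: "0 \<le> t"
      then have rt: "0 \<le> r * t" using r by simp
      have "A * ((- (a / r) * u (r * t) - u (r * t) * v (r * t)) * r)
          = - a * (A * u (r * t)) - c * (A * u (r * t)) * (A * v (r * t))"
        using r by (simp add: field_simps) (simp add: r_def algebra_simps)
      with scale[OF uv(6)[OF rt] t]
      show "((\<lambda>t. A * u (r * t)) has_real_derivative
          - a * (A * u (r * t)) - c * (A * u (r * t)) * (A * v (r * t))) (at t within {0..})" by simp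
      have "A * ((- (b / r) * v (r * t) + (u (r * t))\<^sup>2) * r)
          = - b * (A * v (r * t)) + c * (A * u (r * t))\<^sup>2"
        using r by (simp add: field_simps) (simp add: r_def algebra_simps power2_eq_square)
      with scale[OF uv(7)[OF rt] t]
      show "((\<lambda>t. A * v (r * t)) has_real_derivative
          - b * (A * v (r * t)) + c * (A * u (r * t))\<^sup>2) (at t within {0..})" by simp
    qed
  qed
qed

section \<open>Gluing the steps of the cascade\<close>

lemma smooth_on_interval_if_closed_under_derivative:
  assumes closed: "\<And>f. f \<in> F \<Longrightarrow> \<exists>g\<in>F. \<forall>x\<in>I. (f has_real_derivative g x) (at x within I)"
    and "f \<in> F"
  shows "smooth_on_interval f I"
proof -
  obtain G where G: "\<And>f. f \<in> F \<Longrightarrow> G f \<in> F"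
      "\<And>f x. f \<in> F \<Longrightarrow> x \<in> I \<Longrightarrow> (f has_real_derivative G f x) (at x within I)"
    using closed by metis
  have "(G ^^ k) f \<in> F" for k using \<open>f \<in> F\<close> G(1) by (induction k) auto
  then show ?thesis
    unfolding smooth_on_interval_def using G(2) by (intro exI[of _ "\<lambda>k. (G ^^ k) f"]) auto
qed

lemma smooth_on_interval_cong:
  assumes "smooth_on_interval g I" and "\<And>x. x \<in> I \<Longrightarrow> f x = g x"
  shows "smooth_on_interval f I"
  using assms unfolding smooth_on_interval_def by metis

text \<open>The real algebra generated by \<open>x\<close> and \<open>y\<close>, given inductively
  so that its closure under differentiation can be proved by rule induction.\<close>

inductive_set polynomials_in :: "(real \<Rightarrow> real) \<Rightarrow> (real \<Rightarrow> real) \<Rightarrow> (real \<Rightarrow> real) set"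
  for x y where
  const: "(\<lambda>_. r) \<in> polynomials_in x y"
| fst: "x \<in> polynomials_in x y"
| snd: "y \<in> polynomials_in x y"
| add: "\<lbrakk>f \<in> polynomials_in x y; g \<in> polynomials_in x y\<rbrakk> \<Longrightarrow> (\<lambda>s. f s + g s) \<in> polynomials_in x y"
| mult: "\<lbrakk>f \<in> polynomials_in x y; g \<in> polynomials_in x y\<rbrakk> \<Longrightarrow> (\<lambda>s. f s * g s) \<in> polynomials_in x y"

text \<open>Bootstrapping: the equations replace derivatives of \<open>x\<close> and
  \<open>y\<close> by polynomials in them, so by the sum and product rules the whole algebra is
  closed under differentiation.\<close>

lemma smooth_on_interval_polynomial_ode:
  assumes "xd \<in> polynomials_in x y" and "yd \<in> polynomials_in x y"
    and "\<And>s. s \<in> I \<Longrightarrow> (x has_real_derivative xd s) (at s within I)"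
    and "\<And>s. s \<in> I \<Longrightarrow> (y has_real_derivative yd s) (at s within I)"
  shows "smooth_on_interval x I" and "smooth_on_interval y I"
proof -
  have "\<exists>g\<in>polynomials_in x y. \<forall>s\<in>I. (f has_real_derivative g s) (at s within I)"
    if "f \<in> polynomials_in x y" for f
    using that
  proof induction
    case (const r)
    show ?case by (rule bexI[OF _ polynomials_in.const[of 0]]) auto
  next
    case fst
    then show ?case using assms by blast
  next
    case snd
    then show ?case using assms by blast
  next
    case (add f g)
    then obtain f' g' where *: "f' \<in> polynomials_in x y" "g' \<in> polynomials_in x y"
      "\<forall>s\<in>I. (f has_real_derivative f' s) (at s within I)"
      "\<forall>s\<in>I. (g has_real_derivative g' s) (at s within I)" by blast
    show ?case
      by (rule bexI[OF _ polynomials_in.add[OF *(1,2)]]) (use * in \<open>auto intro!: DERIV_add\<close>)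
  next
    case (mult f g)
    then obtain f' g' where *: "f' \<in> polynomials_in x y" "g' \<in> polynomials_in x y"
      "\<forall>s\<in>I. (f has_real_derivative f' s) (at s within I)"
      "\<forall>s\<in>I. (g has_real_derivative g' s) (at s within I)" by blast
    show ?case
      by (rule bexI[OF _ polynomials_in.add[OF polynomials_in.mult[OF *(1) mult(2)]
            polynomials_in.mult[OF *(2) mult(1)]]])
        (use * in \<open>auto intro!: DERIV_mult\<close>)
  qed
  note smooth_on_interval_if_closed_under_derivative[OF this]
  then show "smooth_on_interval x I" and "smooth_on_interval y I"
    using polynomials_in.fst polynomials_in.snd by blast+
qed

lemma smooth_on_interval_two_mode:
  assumes "\<And>s. s \<in> I \<Longrightarrow> (x has_real_derivative - a * x s - c * x s * y s) (at s within I)"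
    and "\<And>s. s \<in> I \<Longrightarrow> (y has_real_derivative - b * y s + c * (x s)\<^sup>2) (at s within I)"
  shows "smooth_on_interval x I" and "smooth_on_interval y I"
proof -
  have "(\<lambda>s. - a * x s + (- c) * x s * y s) \<in> polynomials_in x y"
    and "(\<lambda>s. - b * y s + c * (x s * x s)) \<in> polynomials_in x y"
    by (intro polynomials_in.intros)+
  from smooth_on_interval_polynomial_ode[OF this, of I] assms
  show "smooth_on_interval x I" and "smooth_on_interval y I"
    by (simp_all add: power2_eq_square)
qed

section \<open>The glued cascade: phases, regularity and equation\<close>

lemma has_real_derivative_shift_atLeast:
  fixes f :: "real \<Rightarrow> real"
  assumes "(f has_real_derivative D) (at (s - l) within {0..})"
  shows "((\<lambda>s. f (s - l)) has_real_derivative D) (at s within {l..})"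
proof -
  have "(f has_real_derivative D) (at (s - l) within (\<lambda>s. s - l) ` {l..})"
    by (rule DERIV_subset[OF assms]) auto
  moreover have "((\<lambda>s. s - l) has_real_derivative 1) (at s within {l..})"
    by (auto intro!: derivative_eq_intros)
  ultimately show ?thesis using DERIV_image_chain by (fastforce simp: o_def)
qed

text \<open>Modes are counted from 0 here. Step \<open>k\<close> lasts \<tau> \<open>k\<close>, in
  local time starting at 0: mode \<open>k\<close> discharges along \<open>U k\<close> while mode
  \<open>Suc k\<close> charges along \<open>V k\<close>, which is why \<open>V k\<close> is damped
  at rate \<open>a (Suc k)\<close>. The end value of \<open>V k\<close> is the start value of
  \<open>U (Suc k)\<close>, so the steps fit together continuously.\<close>

locale cascade =
  fixes a c A \<tau> :: "nat \<Rightarrow> real" and U V :: "nat \<Rightarrow> real \<Rightarrow> real"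
  assumes \<tau>_pos: "0 < \<tau> k"
    and U_0: "U k 0 = A k" and V_0: "V k 0 = 0" and V_\<tau>: "V k (\<tau> k) = A (Suc k)"
    and U_deriv: "0 \<le> s \<Longrightarrow>
      (U k has_real_derivative - a k * U k s - c k * U k s * V k s) (at s within {0..})"
    and V_deriv: "0 \<le> s \<Longrightarrow>
      (V k has_real_derivative - a (Suc k) * V k s + c k * (U k s)\<^sup>2) (at s within {0..})"
begin

definition t :: "nat \<Rightarrow> real" where "t k = (\<Sum>j<k. \<tau> j)"

text \<open>The life of mode \<open>k\<close> has four phases: silent, charging along
  \<open>V (k - 1)\<close>, discharging along \<open>U k\<close>, then free exponential decay. The
  guard \<open>0 < k\<close> excludes charging for mode 0, where \<open>k - 1\<close> would be 0
  again.\<close>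

definition X :: "nat \<Rightarrow> real \<Rightarrow> real" where
  "X k s =
    (if t k \<le> s then
       if s \<le> t (Suc k) then U k (s - t k) else U k (\<tau> k) * exp (- a k * (s - t (Suc k)))
     else if 0 < k \<and> t (k - 1) < s then V (k - 1) (s - t (k - 1)) else 0)"

lemma t_Suc: "t (Suc k) = t k + \<tau> k"
  by (simp add: t_def)

lemma t_less_Suc: "t k < t (Suc k)"
  using \<tau>_pos by (simp add: t_Suc)

lemma X_before: "s \<le> t k \<Longrightarrow> X (Suc k) s = 0"
  using t_less_Suc[of k] by (auto simp: X_def)

text \<open>The end points carry the content, because there the definition uses another branch: the
  left one needs \<open>V_0\<close>, the right one needs that \<open>V k\<close> ends at the value
  \<open>A (Suc k)\<close> where \<open>U (Suc k)\<close> starts.\<close>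

lemma X_charging: "t k \<le> s \<Longrightarrow> s \<le> t (Suc k) \<Longrightarrow> X (Suc k) s = V k (s - t k)"
  using t_less_Suc[of k] t_less_Suc[of "Suc k"]
  by (cases "s = t k"; cases "s = t (Suc k)") (auto simp: X_def V_0 U_0 t_Suc[of k] V_\<tau>)

lemma X_discharging: "t k \<le> s \<Longrightarrow> s \<le> t (Suc k) \<Longrightarrow> X k s = U k (s - t k)"
  by (auto simp: X_def)

lemma X_after: "t (Suc k) \<le> s \<Longrightarrow> X k s = U k (\<tau> k) * exp (- a k * (s - t (Suc k)))"
  using t_less_Suc[of k] by (cases "s = t (Suc k)") (auto simp: X_def, auto simp: t_Suc)

lemma X_t: "X k (t k) = A k"
  using t_less_Suc[of k] by (simp add: X_discharging U_0)

lemma U_shift_deriv: "t k \<le> s \<Longrightarrow> ((\<lambda>s. U k (s - t k)) has_real_derivative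
    - a k * U k (s - t k) - c k * U k (s - t k) * V k (s - t k)) (at s within {t k..})"
  by (rule has_real_derivative_shift_atLeast[OF U_deriv]) simp

lemma V_shift_deriv: "t k \<le> s \<Longrightarrow> ((\<lambda>s. V k (s - t k)) has_real_derivative
    - a (Suc k) * V k (s - t k) + c k * (U k (s - t k))\<^sup>2) (at s within {t k..})"
  by (rule has_real_derivative_shift_atLeast[OF V_deriv]) simp

lemma decay_deriv: "((\<lambda>s. r * exp (- a k * (s - l))) has_real_derivative
    - a k * (r * exp (- a k * (s - l)))) (at s within I)"
  by (auto intro!: derivative_eq_intros)

lemma
  assumes "I \<subseteq> {t k..}"
  shows smooth_U: "smooth_on_interval (\<lambda>s. U k (s - t k)) I"
    and smooth_V: "smooth_on_interval (\<lambda>s. V k (s - t k)) I"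
proof -
  have l: "t k \<le> s" if "s \<in> I" for s using that assms by auto
  note smooth_on_interval_two_mode[OF DERIV_subset[OF U_shift_deriv[OF l] assms]
      DERIV_subset[OF V_shift_deriv[OF l] assms]]
  then show "smooth_on_interval (\<lambda>s. U k (s - t k)) I"
    and "smooth_on_interval (\<lambda>s. V k (s - t k)) I"
    by blast+
qed

lemma smooth_zero: "smooth_on_interval (\<lambda>_. 0) I"
  by (rule smooth_on_interval_if_closed_under_derivative[of "{\<lambda>_. 0}"]) auto

text \<open>Free decay is the two-mode system with zero coupling and vanishing second
  component.\<close>

lemma smooth_decay: "smooth_on_interval (\<lambda>s. r * exp (- a k * (s - l))) I"
proof (rule smooth_on_interval_two_mode(1))
  show "((\<lambda>s. r * exp (- a k * (s - l))) has_real_derivative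
      - a k * (r * exp (- a k * (s - l))) - 0 * (r * exp (- a k * (s - l))) * 0) (at s within I)" for s
    using decay_deriv[of r k l s I] by simp
  show "((\<lambda>_. 0) has_real_derivative - 0 * 0 + 0 * (r * exp (- a k * (s - l)))\<^sup>2) (at s within I)" for s
    by simp
qed

lemma piecewise_smooth_X: "piecewise_smooth_on (X k) {0..<T}"
  unfolding piecewise_smooth_on_def
proof (intro exI conjI allI impI)
  show "finite {t (k - 1), t k, t (Suc k)}" by simp
  fix l r assume lr: "l < r \<and> {l..r} \<subseteq> {0..<T} \<and> {l<..<r} \<inter> {t (k - 1), t k, t (Suc k)} = {}"
  then have "0 \<le> l" by (auto simp: subset_iff)
  have outside: "r \<le> p \<or> p \<le> l" if "p \<in> {t (k - 1), t k, t (Suc k)}" for p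
    using lr that by (meson disjoint_iff greaterThanLessThan_iff not_le)
  \<comment> \<open>With no break point inside, the piece lies within one closed phase. For
    \<open>k = 0\<close> only the first two phases occur, since
    \<open>t 0 = 0 \<le> l\<close>.\<close>
  consider "t (Suc k) \<le> l" | "t k \<le> l" "r \<le> t (Suc k)"
    | j where "k = Suc j" "t j \<le> l" "r \<le> t k" | j where "k = Suc j" "r \<le> t j"
  proof (cases k)
    case 0
    then have "t k \<le> l" using \<open>0 \<le> l\<close> by (simp add: t_def)
    then show thesis using outside[of "t (Suc k)"] that(1,2) by auto
  next
    case (Suc j)
    then show thesis
      using outside[of "t k"] outside[of "t (Suc k)"] outside[of "t j"] that by (metis diff_Suc_1 insertCI)
  qed
  then show "smooth_on_interval (X k) {l..r}"
  proof cases
    case 1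
    show ?thesis by (rule smooth_on_interval_cong[OF smooth_decay X_after]) (use 1 in auto)
  next
    case 2
    show ?thesis by (rule smooth_on_interval_cong[OF smooth_U X_discharging]) (use 2 in auto)
  next
    case 3
    show ?thesis unfolding 3(1)
      by (rule smooth_on_interval_cong[OF smooth_V X_charging]) (use 3 in auto)
  next
    case 4
    show ?thesis unfolding 4(1)
      by (rule smooth_on_interval_cong[OF smooth_zero X_before]) (use 4 in auto)
  qed
qed

lemma continuous_on_X: "continuous_on {0..} (X k)"
proof -
  have U: "continuous_on {t k..t (Suc k)} (X k)"
  proof (rule continuous_on_eq)
    show "continuous_on {t k..t (Suc k)} (\<lambda>s. U k (s - t k))"
      by (rule DERIV_continuous_on, rule DERIV_subset[OF U_shift_deriv]) auto
  qed (simp add: X_discharging)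
  have "continuous_on {t (Suc k)..} (X k)"
  proof (rule continuous_on_eq)
    show "continuous_on {t (Suc k)..} (\<lambda>s. U k (\<tau> k) * exp (- a k * (s - t (Suc k))))"
      by (intro continuous_intros)
  qed (simp add: X_after)
  with U have "continuous_on ({t k..t (Suc k)} \<union> {t (Suc k)..}) (X k)"
    by (intro continuous_on_closed_Un) auto
  also have "{t k..t (Suc k)} \<union> {t (Suc k)..} = {t k..}"
    using t_less_Suc[of k] by auto
  finally have late: "continuous_on {t k..} (X k)" .
  show ?thesis
  proof (cases k)
    case 0
    then show ?thesis using late by (simp add: t_def)
  next
    case (Suc j)
    have "continuous_on {t j..t k} (X k)" unfolding Suc
    proof (rule continuous_on_eq)
      show "continuous_on {t j..t (Suc j)} (\<lambda>s. V j (s - t j))"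
        by (rule DERIV_continuous_on, rule DERIV_subset[OF V_shift_deriv]) auto
    qed (simp add: X_charging)
    with late have "continuous_on ({t j..t k} \<union> {t k..}) (X k)"
      by (intro continuous_on_closed_Un) auto
    moreover have "continuous_on {..t j} (X k)" unfolding Suc
      by (rule continuous_on_eq[of _ "\<lambda>_. 0"]) (auto simp: X_before)
    ultimately have "continuous_on ({..t j} \<union> ({t j..t k} \<union> {t k..})) (X k)"
      by (intro continuous_on_closed_Un[of "{..t j}"] closed_Un) auto
    then show ?thesis by (rule continuous_on_subset) (use Suc in auto)
  qed
qed

text \<open>Away from the transition times \<open>s\<close> lies in an open phase, where
  \<open>X k\<close> coincides with a single formula near \<open>s\<close>. The indicators retain
  exactly the interaction of that phase, and the neighbouring mode is then given by the other
  component of the same two-mode solution.\<close>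

lemma X_ode:
  assumes "0 \<le> s" and "s \<notin> range t"
  shows "(X k has_real_derivative
     - a k * X k s
     + (if k = 0 then 0 else indicator {t (k - 1)<..<t k} s * c (k - 1) * (X (k - 1) s)\<^sup>2)
     - indicator {t k<..<t (Suc k)} s * c k * X k s * X (Suc k) s) (at s)"
proof -
  have ne: "s \<noteq> t j" for j using assms by auto
  have mono: "t (k - 1) \<le> t k" using t_less_Suc[of "k - 1"] by (cases k) auto
  have interior: "at s within {t j..} = at s" if "t j < s" for j
    using that by (intro at_within_interior) simp
  consider "t (Suc k) < s" | "t k < s" "s < t (Suc k)"
    | j where "k = Suc j" "t j < s" "s < t k" | j where "k = Suc j" "s < t j"
  proof (cases k)
    case 0
    then have "t k < s" using ne[of k] \<open>0 \<le> s\<close> by (simp add: t_def)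
    then show thesis using that(1,2) ne[of "Suc k"] by (meson linorder_neqE)
  next
    case (Suc j)
    then show thesis using ne[of k] ne[of "Suc k"] ne[of j] that by (metis linorder_neqE)
  qed
  then show ?thesis
  proof cases
    case 1
    have "(X k has_real_derivative - a k * (U k (\<tau> k) * exp (- a k * (s - t (Suc k))))) (at s)"
      by (rule has_field_derivative_transform_within_open[OF decay_deriv, of "{t (Suc k)<..}"])
        (use 1 X_after in auto)
    then show ?thesis using 1 mono t_less_Suc[of k] X_after[of k s] by (cases "k = 0") auto
  next
    case 2
    have "(X k has_real_derivative
        - a k * U k (s - t k) - c k * U k (s - t k) * V k (s - t k)) (at s)"
      by (rule has_field_derivative_transform_within_open[of "\<lambda>s. U k (s - t k)" _ _ "{t k<..<t (Suc k)}"])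
        (use 2 U_shift_deriv[of k s] interior[of k] X_discharging[of k] in auto)
    then show ?thesis using 2 mono X_discharging[of k s] X_charging[of k s]
      by (cases "k = 0") auto
  next
    case 3
    have "(X (Suc j) has_real_derivative
        - a (Suc j) * V j (s - t j) + c j * (U j (s - t j))\<^sup>2) (at s)"
      by (rule has_field_derivative_transform_within_open[of "\<lambda>s. V j (s - t j)" _ _ "{t j<..<t (Suc j)}"])
        (use 3 V_shift_deriv[of j s] interior[of j] X_charging[of j] in auto)
    then show ?thesis using 3 X_discharging[of j s] X_charging[of j s] by simp
  next
    case 4
    have "(X (Suc j) has_real_derivative 0) (at s)"
      by (rule has_field_derivative_transform_within_open[of "\<lambda>_. 0" _ _ "{..<t j}"])
        (use 4 X_before[of _ j] in auto)
    then show ?thesis using 4 t_less_Suc[of j] X_before[of s j] by simp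
  qed
qed

end

section \<open>Blow-up\<close>

text \<open>Any real \<open>B\<close> above the limit superior would be an eventual strict bound for
  \<open>F\<close> to the left of \<open>T\<close>, and the values along the sequence
  \<open>x\<close> exceed it.\<close>

lemma Limsup_at_left_eq_PInf:
  fixes F :: "real \<Rightarrow> ereal"
  assumes "x \<longlonglongrightarrow> T" and "\<And>k. x k < T" and "\<And>k. ereal (b k) \<le> F (x k)"
    and "filterlim b at_top sequentially"
  shows "Limsup (at_left T) F = \<infinity>"
proof (rule ccontr)
  assume "Limsup (at_left T) F \<noteq> \<infinity>"
  then obtain B where "Limsup (at_left T) F < ereal B"
    by (meson less_PInf_Ex_of_nat ereal_infty_less(1))
  then have "eventually (\<lambda>s. F s < ereal B) (at_left T)" by (rule Limsup_lessD)
  moreover have "filterlim x (at_left T) sequentially"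
    using assms(1,2) by (simp add: filterlim_at less_imp_neq)
  ultimately have "eventually (\<lambda>k. F (x k) < ereal B) sequentially"
    unfolding filterlim_iff by blast
  moreover have "eventually (\<lambda>k. B \<le> b k) sequentially"
    using assms(4) by (simp add: filterlim_at_top)
  ultimately have "eventually (\<lambda>k. False) sequentially"
  proof eventually_elim
    case (elim k)
    then have "ereal B \<le> F (x k)" using assms(3)[of k] by (meson ereal_less_eq(3) order_trans)
    with elim show ?case by simp
  qed
  then show False by simp
qed

section \<open>Choice of the starting index, assembly of the cascade, and divergence\<close>

theorem proposition5p1:
  fixes lam \<alpha> \<delta> :: real
  assumes "lam > 1" and "0 < \<alpha>" and "\<alpha> < 1 / 2" and "0 < \<delta>" and "\<delta> < 1 - 2 * \<alpha>"
  shows "\<exists>(n0 :: nat) (t :: int \<Rightarrow> real) (T :: real) (X :: int \<Rightarrow> real \<Rightarrow> real).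
      t (int n0) = 0
    \<and> (\<forall>n \<ge> int n0. t n < t (n + 1))
    \<and> (\<lambda>k :: nat. t (int (n0 + k))) \<longlonglongrightarrow> T
    \<and> t (int n0 - 1) = 0
    \<and> (\<forall>s \<in> {0..<T}. X (int n0 - 1) s = 0)
    \<and> (\<forall>n \<ge> int n0. continuous_on {0..<T} (X n) \<and> piecewise_smooth_on (X n) {0..<T})
    \<and> (\<forall>k :: nat. k \<ge> 1 \<longrightarrow>
          (\<forall>s. 0 \<le> s \<and> s \<le> t (int (n0 + k) - 1) \<longrightarrow> X (int (n0 + k)) s = 0))
    \<and> (\<forall>n \<ge> int n0. \<forall>s \<in> {0..<T} - t ` {int n0..}.
          (X n has_real_derivative
             (- (lam powr (2 * real_of_int n * \<alpha>)) * X n s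
              + indicator {t (n - 1)<..<t n} s * lam powi (n - 1) * (X (n - 1) s)\<^sup>2
              - indicator {t n<..<t (n + 1)} s * lam powi n * X n s * X (n + 1) s)) (at s))
    \<and> (\<forall>k :: nat. X (int (n0 + k)) (t (int (n0 + k))) = lam powr (- \<delta> * real k))
    \<and> (\<forall>\<delta>' > \<delta>. Limsup (at_left T)
          (\<lambda>s. SUP n \<in> {int n0..}. ereal (lam powr (\<delta>' * real_of_int n) * \<bar>X n s\<bar>)) = \<infinity>)"
proof -
  \<comment> \<open>The ratio of the prescribed amplitudes of consecutive modes.\<close>
  define \<theta> where "\<theta> = lam powr (- \<delta>)"
  have "0 < \<theta>" "\<theta> < 1" using assms by (auto simp: \<theta>_def powr_less_one)
  then obtain \<epsilon> S :: real where "0 < \<epsilon>" and "0 < S" and transfer: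
    "\<And>a b c A. \<lbrakk>0 \<le> a; a \<le> b; 0 < c; 0 < A; b \<le> \<epsilon> * (c * A)\<rbrakk> \<Longrightarrow>
      \<exists>\<tau> x y. 0 < \<tau> \<and> \<tau> \<le> S / (c * A) \<and> x 0 = A \<and> y 0 = 0 \<and> y \<tau> = \<theta> * A \<and>
        (\<forall>t\<ge>0. (x has_real_derivative - a * x t - c * x t * y t) (at t within {0..}) \<and>
               (y has_real_derivative - b * y t + c * (x t)\<^sup>2) (at t within {0..}))"
    using two_mode_transfer_scaled[of \<theta>] by metis
  \<comment> \<open>As \<alpha> is below 1/2, a large \<open>n0\<close> makes the dissipation of the
    first step weak enough relative to \<epsilon>; the fact \<open>weak\<close> below carries this
    over to all later steps.\<close>
  have "1 < lam powr (1 - 2 * \<alpha>)" using assms by simp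
  then obtain n0 where "lam powr (2 * \<alpha>) / \<epsilon> < (lam powr (1 - 2 * \<alpha>)) ^ n0"
    using real_arch_pow by blast
  then have n0: "lam powr (2 * \<alpha>) \<le> \<epsilon> * lam powr ((1 - 2 * \<alpha>) * real n0)"
    using \<open>0 < \<epsilon>\<close> assms by (simp add: powr_powr divide_simps mult_ac flip: powr_realpow)
  define a where "a k = lam powr (2 * real (n0 + k) * \<alpha>)" for k
  define c where "c k = lam ^ (n0 + k)" for k
  define A where "A k = lam powr (- \<delta> * real k)" for k
  have cA: "c k * A k = lam powr (real n0 + (1 - \<delta>) * real k)" for k
    using assms by (simp add: c_def A_def algebra_simps flip: powr_realpow powr_add)
  \<comment> \<open>The quotient of \<open>a (Suc k)\<close> by \<open>c k * A k\<close> is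
    \<open>lam\<close> to the exponent \<open>2 * \<alpha> - (1 - 2 * \<alpha>) * n0 - (1 - \<delta>
    - 2 * \<alpha>) * k\<close>. Because \<delta> is less than \<open>1 - 2 * \<alpha>\<close>, it
    is largest at \<open>k = 0\<close>, where the choice of \<open>n0\<close> applies.\<close>
  have weak: "a (Suc k) \<le> \<epsilon> * (c k * A k)" for k
  proof -
    have "a (Suc k) = lam powr (2 * \<alpha>) * lam powr (2 * real (n0 + k) * \<alpha>)"
      by (simp add: a_def algebra_simps flip: powr_add)
    also have "\<dots> \<le> \<epsilon> * lam powr ((1 - 2 * \<alpha>) * real n0) * lam powr (2 * real (n0 + k) * \<alpha>)"
      using n0 by (intro mult_right_mono) auto
    also have "\<dots> = \<epsilon> * lam powr (real n0 + (2 * \<alpha>) * real k)"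
      by (simp add: algebra_simps flip: powr_add)
    also have "\<dots> \<le> \<epsilon> * (c k * A k)"
      unfolding cA using assms \<open>0 < \<epsilon>\<close>
      by (intro mult_left_mono powr_mono add_left_mono mult_right_mono) auto
    finally show ?thesis .
  qed
  have "\<theta> * A k = A (Suc k)" for k
    by (simp add: \<theta>_def A_def algebra_simps flip: powr_add)
  moreover have "0 \<le> a k" "a k \<le> a (Suc k)" "0 < c k" "0 < A k" for k
    using assms by (auto simp: a_def c_def A_def)
  ultimately have "\<exists>\<tau> x y. 0 < \<tau> \<and> \<tau> \<le> S / (c k * A k) \<and> x 0 = A k \<and> y 0 = 0 \<and> y \<tau> = A (Suc k) \<and>
      (\<forall>t\<ge>0. (x has_real_derivative - a k * x t - c k * x t * y t) (at t within {0..}) \<and>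
             (y has_real_derivative - a (Suc k) * y t + c k * (x t)\<^sup>2) (at t within {0..}))" for k
    using transfer[of "a k" "a (Suc k)" "c k" "A k"] weak[of k] by simp
  then obtain \<tau> U V where UV: "\<And>k. 0 < \<tau> k \<and> \<tau> k \<le> S / (c k * A k) \<and> U k 0 = A k \<and> V k 0 = 0 \<and>
      V k (\<tau> k) = A (Suc k) \<and>
      (\<forall>t\<ge>0. (U k has_real_derivative - a k * U k t - c k * U k t * V k t) (at t within {0..}) \<and>
             (V k has_real_derivative - a (Suc k) * V k t + c k * (U k t)\<^sup>2) (at t within {0..}))"
    by metis
  interpret cascade a c A \<tau> U V
    by unfold_locales (use UV in auto)
  \<comment> \<open>The bound \<open>S / (c k * A k)\<close> is geometric in \<open>k\<close> with
    ratio \<open>lam powr (- (1 - \<delta>))\<close>, which is below 1 because \<delta> is; hence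
    the blow-up time is finite.\<close>
  have "summable \<tau>"
  proof (rule summable_comparison_test')
    show "summable (\<lambda>k. S * (lam powr (- real n0) * (lam powr (- (1 - \<delta>))) ^ k))"
      using assms by (intro summable_mult summable_geometric) (auto intro!: powr_less_one)
    show "norm (\<tau> k) \<le> S * (lam powr (- real n0) * (lam powr (- (1 - \<delta>))) ^ k)" for k
    proof -
      have "norm (\<tau> k) \<le> S / (c k * A k)" using UV[of k] by simp
      also have "\<dots> = S * lam powr (- (real n0 + (1 - \<delta>) * real k))"
        unfolding cA by (simp only: powr_minus divide_inverse)
      also have "\<dots> = S * (lam powr (- real n0) * (lam powr (- (1 - \<delta>))) ^ k)"
        using assms by (simp add: powr_powr algebra_simps flip: powr_realpow powr_add)
      finally show ?thesis .
    qed
  qed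
  define T where "T = suminf \<tau>"
  have lim: "t \<longlonglongrightarrow> T"
    unfolding t_def T_def by (rule summable_LIMSEQ) fact
  have "incseq t" using t_less_Suc by (intro incseq_SucI less_imp_le)
  then have t_less_T: "t k < T" for k
    using incseq_le[OF _ lim, of "Suc k"] t_less_Suc[of k] by simp
  \<comment> \<open>Return to the absolute integer index. The value 0 below \<open>n0\<close>
    realises the conventions for time and mode \<open>n0 - 1\<close>.\<close>
  define t' where "t' n = (if n < int n0 then 0 else t (nat (n - int n0)))" for n
  define X' where "X' n = (if n < int n0 then (\<lambda>_. 0) else X (nat (n - int n0)))" for n
  have t': "t' (int n0 + int k) = t k" and X': "X' (int n0 + int k) = X k" for k
    by (auto simp: t'_def X'_def)
  have index: "\<exists>k. n = int n0 + int k" if "int n0 \<le> n" for n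
    using that zle_iff_zadd by blast
  have Suc_index: "int n0 + int k + 1 = int n0 + int (Suc k)"
    and pred_index: "int n0 + int (Suc k) - 1 = int n0 + int k" for k by auto
  show ?thesis
  proof (intro exI[of _ n0] exI[of _ t'] exI[of _ T] exI[of _ X'] conjI allI impI ballI)
    show "t' (int n0) = 0" using t'[of 0] by (simp add: t_def)
    show "t' (int n0 - 1) = 0" "X' (int n0 - 1) s = 0" for s by (auto simp: t'_def X'_def)
    show "(\<lambda>k. t' (int (n0 + k))) \<longlonglongrightarrow> T" using lim by (simp add: t')
    show "X' (int (n0 + k)) (t' (int (n0 + k))) = lam powr (- \<delta> * real k)" for k
      by (simp add: t' X' X_t A_def)
  next
    fix n assume "int n0 \<le> n"
    then obtain k where k: "n = int n0 + int k" using index by blast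
    show "t' n < t' (n + 1)" unfolding k Suc_index t' by (rule t_less_Suc)
    show "continuous_on {0..<T} (X' n)"
      unfolding k X' by (rule continuous_on_subset[OF continuous_on_X]) auto
    show "piecewise_smooth_on (X' n) {0..<T}" unfolding k X' by (rule piecewise_smooth_X)
    fix s assume s: "s \<in> {0..<T} - t' ` {int n0..}"
    have "s \<noteq> t j" for j
      using s t'[of j] by (auto simp: image_iff dest!: bspec[of _ _ "int n0 + int j"])
    then have ode: "(X k has_real_derivative
       - a k * X k s
       + (if k = 0 then 0 else indicator {t (k - 1)<..<t k} s * c (k - 1) * (X (k - 1) s)\<^sup>2)
       - indicator {t k<..<t (Suc k)} s * c k * X k s * X (Suc k) s) (at s)"
      using s by (intro X_ode) auto
    have ak: "a k = lam powr (2 * real_of_int n * \<alpha>)" by (simp add: a_def k)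
    have ck: "lam powi (int n0 + int j) = c j" for j
      unfolding c_def of_nat_add[symmetric] by (rule power_int_of_nat)
    \<comment> \<open>For \<open>k = 0\<close> both sides vanish because mode \<open>n0 - 1\<close>
      is zero; otherwise this is a shift of the index.\<close>
    have input: "indicator {t' (n - 1)<..<t' n} s * lam powi (n - 1) * (X' (n - 1) s)\<^sup>2
        = (if k = 0 then 0 else indicator {t (k - 1)<..<t k} s * c (k - 1) * (X (k - 1) s)\<^sup>2)"
    proof (cases k)
      case 0
      then show ?thesis by (simp add: k X'_def)
    next
      case (Suc j)
      then show ?thesis unfolding k Suc pred_index t' X' ck by simp
    qed
    show "(X' n has_real_derivative
             (- (lam powr (2 * real_of_int n * \<alpha>)) * X' n s
              + indicator {t' (n - 1)<..<t' n} s * lam powi (n - 1) * (X' (n - 1) s)\<^sup>2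
              - indicator {t' n<..<t' (n + 1)} s * lam powi n * X' n s * X' (n + 1) s)) (at s)"
      unfolding input ak[symmetric] unfolding k Suc_index t' X' ck by (rule ode)
  next
    fix k s assume "1 \<le> k" and s: "0 \<le> s \<and> s \<le> t' (int (n0 + k) - 1)"
    then obtain j where j: "k = Suc j" by (cases k) auto
    from s show "X' (int (n0 + k)) s = 0"
      unfolding j of_nat_add pred_index t' X' by (intro X_before) simp
  next
    fix \<delta>' assume "\<delta> < \<delta>'"
    \<comment> \<open>At time \<open>t k\<close> test the supremum with mode \<open>n0 + k\<close>,
      whose amplitude there is \<open>lam powr (- \<delta> * k)\<close>. The resulting lower bound
      \<open>b k\<close> grows geometrically with ratio
      \<open>lam powr (\<delta>' - \<delta>)\<close>.\<close>
    define b where "b k = lam powr (\<delta>' * real (n0 + k)) * lam powr (- \<delta> * real k)" for k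
    show "Limsup (at_left T)
          (\<lambda>s. SUP n \<in> {int n0..}. ereal (lam powr (\<delta>' * real_of_int n) * \<bar>X' n s\<bar>)) = \<infinity>"
    proof (rule Limsup_at_left_eq_PInf[OF lim t_less_T])
      show "ereal (b k) \<le> (SUP n \<in> {int n0..}. ereal (lam powr (\<delta>' * real_of_int n) * \<bar>X' n (t k)\<bar>))"
        for k
        by (rule SUP_upper2[of "int n0 + int k"]) (auto simp: X' X_t A_def b_def)
      have "b = (\<lambda>k. lam powr (\<delta>' * real n0) * (lam powr (\<delta>' - \<delta>)) ^ k)"
        using assms
        by (auto simp: b_def fun_eq_iff powr_powr algebra_simps simp flip: powr_realpow powr_add)
      moreover have "filterlim (\<lambda>k. (lam powr (\<delta>' - \<delta>)) ^ k) at_top sequentially"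
        using assms \<open>\<delta> < \<delta>'\<close>
        by (intro filterlim_at_infinity_imp_filterlim_at_top filterlim_realpow_sequentially_gt1) auto
      ultimately show "filterlim b at_top sequentially"
        using assms by (auto intro!: filterlim_tendsto_pos_mult_at_top[OF tendsto_const])
    qed
  qed
qed

end
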